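(* Let $N\ge2$ and $F\in GL_N(\mathbb{C})$ be such that $\mathrm{Tr}(F^*F)=\mathrm{Tr}((F^*F)^{-1})$, and define $0<q\le1$ by $q+q^{-1}=\mathrm{Tr}(F^*F)$. Then $\omega(R(U_F^+))=r_q>1$, where $r_q$ is the largest real root of the polynomial $P_q(z)=z^3-(2q^{-2}+3+2q^2)z^2+2(q^{-2}+1+q^2)z-2$. In particular $R(U_F^+)$ has uniform exponential growth (i.e. $\omega(R(U_F^+))>1$).
   Context: A fusion algebra $(R,d)$ consists of a set $I$ with distinguished $e$ and involution $\alpha\mapsto\bar\alpha$, a unital ring structure on $R=\mathbb{Z}[I]$ with unit $e$ and $\xi\eta=\sum_\alpha N^\alpha_{\xi,\eta}\alpha$, $N^\alpha_{\xi,\eta}\in\mathbb{Z}_{\ge0}$ finitely many nonzero, the involution extending to a $\mathbb{Z}$-linear antimultiplicative involution with Frobenius reciprocity $N^\alpha_{\xi,\eta}=N^\xi_{\alpha,\bar\eta}=N^\eta_{\bar\xi,\alpha}$, and a $\mathbb{Z}$-linear multiplicative $d:R\to\mathbb{R}$ with $d(\bar\alpha)=d(\alpha)\ge1$ on $I$. Write $\alpha\subseteq r$ if $\alpha$ has nonzero coefficient in $r$; $|A|=\sum_{\alpha\in A}d(\alpha)^2$. A finite generating set is a finite $X\subseteq I$, $\bar X=X$, such that each $\alpha\in I$ satisfies $\alpha\subseteq x_1\cdots x_n$ for some $x_i\in X$; $\ell_X(e)=0$ and $\ell_X(\alpha)$ is the least such $n\ge 1$ otherwise; $B_X(n)=\{\alpha:\ell_X(\alpha)\le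 n\}$; $\omega_X(R,d)=\lim_n|B_X(n)|^{1/n}$ (exists) and $\omega(R,d)=\inf_X\omega_X(R,d)$ over finite generating sets. $R(U_F^+)$ denotes the fusion algebra of the free unitary quantum group $U_F^+$ with its quantum dimension. Concretely (Banica): $I$ is the free monoid on two letters $\alpha,\bar\alpha$ ($\alpha$ the fundamental representation, $e$ the empty word), the involution reverses a word and interchanges $\alpha\leftrightarrow\bar\alpha$, and the product is $x\cdot y=\sum_{a,b,c:\ x=ac,\ y=\bar c b} ab$. For $n\ge1$ let $w^n_{+1}=\alpha\bar\alpha\alpha\cdots$ and $w^n_{-1}=\bar\alpha\alpha\bar\alpha\cdots$ ($n$ letters); every nonempty word is uniquely a concatenation of maximal alternating blocks $w^{k_1}_{\varepsilon_1}\cdots w^{k_m}_{\varepsilon_m}$, and its quantum dimension is $[k_1+1]_q\cdots[k_m+1]_q$, where $[x]_q=\frac{q^{-x}-q^x}{q^{-1}-q}$ for $q<1$ and $[x]_1=x$. *)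

theory Defs
  imports "HOL-Analysis.Analysis"
begin

text \<open>A fusion algebra is given by its index set (a HOL type 'i), the unit e,
the involution bar, the structure constants Nc a x y (coefficient of a in x*y)
and the dimension function d on I.  Since all structure constants are
nonnegative, the support of a product x1...xn is computed iteratively.\<close>

fun prod_supp :: "('i \<Rightarrow> 'i \<Rightarrow> 'i \<Rightarrow> nat) \<Rightarrow> 'i list \<Rightarrow> 'i set" where
  "prod_supp Nc [] = {}"
| "prod_supp Nc [x] = {x}"
| "prod_supp Nc (x # y # ys) =
     {a. \<exists>b \<in> prod_supp Nc (y # ys). Nc a x b > 0}"

definition gen_set :: "('i \<Rightarrow> 'i) \<Rightarrow> ('i \<Rightarrow> 'i \<Rightarrow> 'i \<Rightarrow> nat) \<Rightarrow> 'i set \<Rightarrow> bool" where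
  "gen_set bar Nc X \<longleftrightarrow> finite X \<and> bar ` X = X \<and>
     (\<forall>a. \<exists>xs. xs \<noteq> [] \<and> set xs \<subseteq> X \<and> a \<in> prod_supp Nc xs)"

definition word_len :: "'i \<Rightarrow> ('i \<Rightarrow> 'i \<Rightarrow> 'i \<Rightarrow> nat) \<Rightarrow> 'i set \<Rightarrow> 'i \<Rightarrow> nat" where
  "word_len e Nc X a = (if a = e then 0 else
     (LEAST n. n \<ge> 1 \<and> (\<exists>xs. set xs \<subseteq> X \<and> length xs = n \<and> a \<in> prod_supp Nc xs)))"

definition ball_X :: "'i \<Rightarrow> ('i \<Rightarrow> 'i \<Rightarrow> 'i \<Rightarrow> nat) \<Rightarrow> 'i set \<Rightarrow> nat \<Rightarrow> 'i set" where
  "ball_X e Nc X n = {a. word_len e Nc X a \<le> n}"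

definition set_size :: "('i \<Rightarrow> real) \<Rightarrow> 'i set \<Rightarrow> real" where
  "set_size d A = (\<Sum>a\<in>A. (d a)\<^sup>2)"

definition omega_X :: "'i \<Rightarrow> ('i \<Rightarrow> 'i \<Rightarrow> 'i \<Rightarrow> nat) \<Rightarrow> ('i \<Rightarrow> real) \<Rightarrow> 'i set \<Rightarrow> real" where
  "omega_X e Nc d X = lim (\<lambda>n. set_size d (ball_X e Nc X n) powr (1 / real n))"

definition omega :: "'i \<Rightarrow> ('i \<Rightarrow> 'i) \<Rightarrow> ('i \<Rightarrow> 'i \<Rightarrow> 'i \<Rightarrow> nat) \<Rightarrow> ('i \<Rightarrow> real) \<Rightarrow> real" where
  "omega e bar Nc d = (INF X \<in> {X. gen_set bar Nc X}. omega_X e Nc d X)"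

section \<open>The fusion algebra of U_F^+ (Banica)\<close>

text \<open>Words over {alpha, alpha-bar}: True = alpha, False = alpha-bar.\<close>
type_synonym uword = "bool list"

definition U_e :: uword where "U_e = []"

definition U_bar :: "uword \<Rightarrow> uword" where "U_bar w = rev (map Not w)"

text \<open>x * y = sum over decompositions x = a c, y = bar(c) b of a b;
coefficient of w = number of such c with a b = w.\<close>
definition U_N :: "uword \<Rightarrow> uword \<Rightarrow> uword \<Rightarrow> nat" where
  "U_N w x y = card {c. \<exists>a b. x = a @ c \<and> y = U_bar c @ b \<and> w = a @ b}"

fun blocks :: "uword \<Rightarrow> nat list" where
  "blocks [] = []"
| "blocks [a] = [1]"
| "blocks (a # b # w) = (let r = blocks (b # w) in
     if a \<noteq> b then Suc (hd r) # tl r else 1 # r)"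

definition qnum :: "real \<Rightarrow> nat \<Rightarrow> real" where
  "qnum q x = (if q < 1 then (q powr (- real x) - q powr (real x)) / (1 / q - q) else real x)"

definition qdim :: "real \<Rightarrow> uword \<Rightarrow> real" where
  "qdim q w = prod_list (map (\<lambda>k. qnum q (k + 1)) (blocks w))"

definition P_q :: "real \<Rightarrow> real \<Rightarrow> real" where
  "P_q q z = z ^ 3 - (2 / q\<^sup>2 + 3 + 2 * q\<^sup>2) * z\<^sup>2 + 2 * (1 / q\<^sup>2 + 1 + q\<^sup>2) * z - 2"

definition r_q :: "real \<Rightarrow> real" where
  "r_q q = Max {z. P_q q z = 0}"

definition adjoint_mat :: "complex^'n^'n \<Rightarrow> complex^'n^'n" where
  "adjoint_mat F = (\<chi> i j. cnj (F $ j $ i))"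

end

theory Submission
  imports Defs
begin

text \<open>Multiplicativity of the dimension makes the ball sizes submultiplicative, so all growth rates
  exist by Fekete's lemma. For the fundamental generators the ball of radius \<open>n\<close> consists of the
  words of length at most \<open>n\<close>, whose total squared dimension is governed by a linear recursion with
  characteristic polynomial \<open>P_q\<close>. For an arbitrary generating set \<open>X\<close>, the grading
  \<open>\<alpha> \<mapsto> 1\<close>, \<open>\<alpha>-bar \<mapsto> -1\<close> forces some \<open>x \<in> X\<close> to have nonzero degree; substituting \<open>x\<close> and its
  conjugate for the two letters is an injection of words that does not decrease dimensions, so no
  generating set grows more slowly than the fundamental one.\<close>

section \<open>Subadditive sequences\<close>

lemma subadditive_mult_le:
  fixes g :: "nat \<Rightarrow> real"
  assumes "\<And>m n. g (m + n) \<le> g m + g n"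
  shows "g (k * m + r) \<le> real k * g m + g r"
proof (induction k)
  case (Suc k)
  have "g (Suc k * m + r) = g (m + (k * m + r))" by (simp add: add.assoc)
  also have "\<dots> \<le> g m + g (k * m + r)" by (rule assms)
  also have "\<dots> \<le> g m + (real k * g m + g r)" using Suc by simp
  finally show ?case by (simp add: algebra_simps)
qed simp

text \<open>Choose \<open>m\<close> with \<open>g m / m\<close> close to the infimum and divide
  \<open>n\<close> by \<open>m\<close> with remainder. The remainders contribute at most
  \<open>C\<close>, which disappears after division by \<open>n\<close>.\<close>

lemma fekete_convergent:
  fixes g :: "nat \<Rightarrow> real"
  assumes sub: "\<And>m n. g (m + n) \<le> g m + g n" and pos: "\<And>n. 0 \<le> g n"
  shows "convergent (\<lambda>n. g n / real n)"
proof -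
  define L where "L = (INF n\<in>{1..}. g n / real n)"
  have bdd: "bdd_below ((\<lambda>n. g n / real n) ` {1..})"
    by (rule bdd_belowI[of _ 0]) (auto simp: pos)
  have "(\<lambda>n. g n / real n) \<longlonglongrightarrow> L"
  proof (rule LIMSEQ_I)
    fix e :: real assume e: "0 < e"
    have "\<exists>m\<in>{1..}. g m / real m < L + e / 2"
      using cInf_lessD[of "(\<lambda>n. g n / real n) ` {1..}" "L + e / 2"] e
      unfolding L_def by fastforce
    then obtain m where m: "m \<ge> 1" "g m / real m < L + e / 2" by auto
    define C where "C = Max (g ` {..<m})"
    have C: "g (n mod m) \<le> C" for n
      unfolding C_def using m(1) by (intro Max_ge) auto
    have C0: "0 \<le> C" using C[of 0] pos[of "0 mod m"] by linarith
    obtain N :: nat where N: "real N > 2 * C / e" using reals_Archimedean2 by blast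
    show "\<exists>no. \<forall>n\<ge>no. norm (g n / real n - L) < e"
    proof (intro exI allI impI)
      fix n assume n: "n \<ge> Suc N"
      have lower: "L \<le> g n / real n"
        unfolding L_def using n by (intro cINF_lower bdd) auto
      have "g n \<le> real (n div m) * g m + C"
        using subadditive_mult_le[of g, OF sub, of "n div m" m "n mod m"] C[of n] by simp
      also have "real (n div m) * g m \<le> real n / real m * g m"
        by (intro mult_right_mono pos of_nat_div_le_of_nat)
      finally have "g n / real n \<le> g m / real m + C / real n"
        using n by (simp add: field_simps)
      moreover have "C / real n < e / 2"
      proof -
        have "2 * C / e < real n" using N n by linarith
        thus ?thesis using e n by (simp add: field_simps)
      qed
      ultimately show "norm (g n / real n - L) < e"
        unfolding real_norm_def using lower m(2) by linarith
    qed
  qed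
  thus ?thesis by (auto simp: convergent_def)
qed

text \<open>Fekete's lemma for \<open>ln (f n)\<close>; \<open>1 \<le> f n\<close> keeps the
  logarithms nonnegative.\<close>

lemma submultiplicative_root_convergent:
  fixes f :: "nat \<Rightarrow> real"
  assumes sub: "\<And>m n. f (m + n) \<le> f m * f n" and ge1: "\<And>n. 1 \<le> f n"
  shows "convergent (\<lambda>n. f n powr (1 / real n))"
proof -
  have pos: "0 < f n" for n using ge1[of n] by linarith
  have "ln (f (m + n)) \<le> ln (f m) + ln (f n)" for m n
    using sub[of m n] pos by (simp flip: ln_mult_pos)
  then obtain L where "(\<lambda>n. ln (f n) / real n) \<longlonglongrightarrow> L"
    using fekete_convergent[of "\<lambda>n. ln (f n)"] ge1 by (auto simp: convergent_def)
  from tendsto_exp[OF this] have "(\<lambda>n. f n powr (1 / real n)) \<longlonglongrightarrow> exp L"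
    using pos by (simp add: powr_def less_imp_neq[OF pos, symmetric])
  thus ?thesis by (auto simp: convergent_def)
qed

section \<open>The quantum dimension as a second-order recursion\<close>

text \<open>The quantum dimension without reference to blocks, with \<delta> in the role of
  \<open>q + 1 / q\<close>. Within a block this is the Chebyshev-type recursion of the q-numbers; a
  repeated letter opens a new block.\<close>

fun wdim :: "real \<Rightarrow> uword \<Rightarrow> real" where
  "wdim \<delta> [] = 1"
| "wdim \<delta> [a] = \<delta>"
| "wdim \<delta> (a # b # w) = \<delta> * wdim \<delta> (b # w) - (if a \<noteq> b then wdim \<delta> w else 0)"

lemma qnum_0 [simp]: "qnum q 0 = 0"
  by (simp add: qnum_def)

lemma qnum_Suc_0 [simp]:
  assumes "0 < q" "q \<le> 1"
  shows "qnum q (Suc 0) = 1"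
proof (cases "q < 1")
  case True
  hence "1 / q - q \<noteq> 0" using assms mult_strict_mono[of q 1 q 1] by (auto simp: field_simps)
  thus ?thesis using assms True by (simp add: qnum_def powr_minus inverse_eq_divide)
qed (use assms in \<open>simp add: qnum_def\<close>)

lemma qnum_Suc_Suc:
  assumes "0 < q" "q \<le> 1"
  shows "qnum q (Suc (Suc n)) = (q + 1 / q) * qnum q (Suc n) - qnum q n"
proof (cases "q < 1")
  case True
  have m: "q powr (- real x) = 1 / q ^ x" for x
    using assms by (simp add: powr_minus powr_realpow divide_simps)
  have pp: "q powr real x = q ^ x" for x using assms by (simp add: powr_realpow)
  have "1 / q ^ Suc (Suc n) - q ^ Suc (Suc n)
      = (q + 1 / q) * (1 / q ^ Suc n - q ^ Suc n) - (1 / q ^ n - q ^ n)"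
    using assms by (simp add: field_simps)
  thus ?thesis using True unfolding qnum_def m pp by (simp flip: diff_divide_distrib)
next
  case False
  hence "q = 1" using assms by simp
  thus ?thesis by (simp add: qnum_def)
qed

lemma blocks_eq_Nil_iff [simp]: "blocks w = [] \<longleftrightarrow> w = []"
  by (induction w rule: blocks.induct) (auto simp: Let_def)

text \<open>A different letter in front lengthens the first block, where [k+2] = \<delta>[k+1] -
  [k]; [1] = 1 accounts for a block that is used up. An equal letter adds a block of length 1, with
  factor [2] = \<delta>.\<close>

lemma qdim_eq_wdim:
  assumes "0 < q" "q \<le> 1"
  shows "qdim q w = wdim (q + 1 / q) w"
proof (induction w rule: induct_list012)
  case (3 a b w)
  have q2: "qnum q (Suc (Suc 0)) = q + 1 / q"
    using assms by (simp add: qnum_Suc_Suc)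
  have split: "r \<noteq> [] \<Longrightarrow> prod_list (map f r) = f (hd r) * prod_list (map f (tl r))"
    for f :: "nat \<Rightarrow> real" and r by (cases r) auto
  have "qdim q (a # b # w) = (q + 1 / q) * qdim q (b # w) - (if a \<noteq> b then qdim q w else 0)"
  proof (cases w)
    case Nil
    thus ?thesis using assms by (simp add: qdim_def q2 qnum_Suc_Suc)
  next
    case (Cons c v)
    hence "blocks w \<noteq> []" by simp
    from split[OF this] show ?thesis using assms Cons
      by (simp add: qdim_def Let_def qnum_Suc_Suc algebra_simps)
  qed
  thus ?case using 3 by simp
qed (use assms in \<open>simp_all add: qdim_def qnum_Suc_Suc\<close>)

section \<open>Monotonicity and product formula for dimensions\<close>

context
  fixes \<delta> :: real
  assumes delta_ge_2: "2 \<le> \<delta>"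
begin

text \<open>If z \<le> y are consecutive dimensions, then \<delta>y - z \<ge> 2y - z \<ge> y.
  Positivity is carried along because \<open>2 \<le> \<delta>\<close> is multiplied by y.\<close>

lemma wdim_Cons_ge: "1 \<le> wdim \<delta> w \<and> wdim \<delta> w \<le> wdim \<delta> (a # w)"
proof (induction w arbitrary: a)
  case (Cons b w)
  have "2 * wdim \<delta> (b # w) \<le> \<delta> * wdim \<delta> (b # w)"
    using Cons[of b] delta_ge_2 by (intro mult_right_mono) auto
  hence "wdim \<delta> (b # w) \<le> wdim \<delta> (a # b # w)"
    using Cons[of b] unfolding wdim.simps by (smt (verit))
  thus ?case using Cons[of b] by linarith
qed (use delta_ge_2 in auto)

lemma wdim_ge_1: "1 \<le> wdim \<delta> w"
  using wdim_Cons_ge by blast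

lemma wdim_le_Cons: "wdim \<delta> w \<le> wdim \<delta> (a # w)"
  using wdim_Cons_ge by blast

lemma wdim_ge_delta: "w \<noteq> [] \<Longrightarrow> \<delta> \<le> wdim \<delta> w"
proof (induction w rule: induct_list012)
  case (3 a b w)
  thus ?case using wdim_le_Cons[of "b # w" a] by simp
qed auto

lemma wdim_le_power: "wdim \<delta> w \<le> \<delta> ^ length w"
proof (induction w rule: induct_list012)
  case (3 a b w)
  have "wdim \<delta> (a # b # w) \<le> \<delta> * wdim \<delta> (b # w)"
    using wdim_ge_1[of w] by auto
  also have "\<dots> \<le> \<delta> * \<delta> ^ length (b # w)"
    using 3 delta_ge_2 by (intro mult_left_mono) auto
  finally show ?case by simp
qed auto

text \<open>The numerical counterpart of the fusion rule: the letters \<open>a\<close> and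
  \<open>b\<close> either stay or, being conjugate when different, cancel.\<close>

lemma wdim_mult:
  "wdim \<delta> (x @ [a]) * wdim \<delta> (b # y) =
     wdim \<delta> (x @ a # b # y) + (if a \<noteq> b then wdim \<delta> x * wdim \<delta> y else 0)"
  by (induction x rule: induct_list012) (auto simp: algebra_simps)

lemma wdim_break: "wdim \<delta> (x @ a # a # y) = wdim \<delta> (x @ [a]) * wdim \<delta> (a # y)"
  by (simp add: wdim_mult)

end

section \<open>Supports of products of words\<close>

lemma U_bar_Nil [simp]: "U_bar [] = []"
  and U_bar_append [simp]: "U_bar (x @ y) = U_bar y @ U_bar x"
  and U_bar_U_bar [simp]: "U_bar (U_bar x) = x"
  and length_U_bar [simp]: "length (U_bar x) = length x"
  and U_bar_Cons: "U_bar (a # x) = U_bar x @ [\<not> a]"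
  by (simp_all add: U_bar_def rev_map comp_def)

lemma U_N_pos_iff:
  "0 < U_N w x y \<longleftrightarrow> (\<exists>a b c. x = a @ c \<and> y = U_bar c @ b \<and> w = a @ b)"
proof -
  let ?C = "{c. \<exists>a b. x = a @ c \<and> y = U_bar c @ b \<and> w = a @ b}"
  \<comment> \<open>\<open>card\<close> of an infinite set is 0, so finiteness is needed; every
    \<open>c\<close> is a suffix of \<open>x\<close>.\<close>
  have "?C \<subseteq> (\<lambda>n. drop n x) ` {..length x}"
  proof
    fix c assume "c \<in> ?C"
    then obtain a where "x = a @ c" by auto
    hence "c = drop (length a) x \<and> length a \<le> length x" by simp
    thus "c \<in> (\<lambda>n. drop n x) ` {..length x}" by blast
  qed
  hence "finite ?C" by (rule finite_subset) simp
  thus ?thesis unfolding U_N_def by (auto simp: card_gt_0_iff)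
qed

definition U_supp :: "uword \<Rightarrow> uword \<Rightarrow> uword set" where
  "U_supp x y = {w. 0 < U_N w x y}"

lemma U_supp_eq: "U_supp x y = {a @ b | a b. \<exists>c. x = a @ c \<and> y = U_bar c @ b}"
  unfolding U_supp_def U_N_pos_iff by blast

lemma append_in_U_supp: "x @ y \<in> U_supp x y"
  unfolding U_supp_eq
  by (intro CollectI exI[of _ x] exI[of _ y] conjI exI[of _ "[]"]) auto

lemma U_supp_Nil [simp]: "U_supp [] y = {y}" "U_supp x [] = {x}"
  by (auto simp: U_supp_eq U_bar_def)

text \<open>Cancellation starts with the innermost pair \<open>a\<close>, \<open>b\<close>, if at
  all, and then continues between \<open>x\<close> and \<open>y\<close>.\<close>

lemma U_supp_snoc_Cons:
  "U_supp (x @ [a]) (b # y) = insert (x @ a # b # y) (if a \<noteq> b then U_supp x y else {})"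
    (is "_ = ?R")
proof (intro equalityI subsetI)
  fix w assume "w \<in> U_supp (x @ [a]) (b # y)"
  then obtain u v c where *: "x @ [a] = u @ c" "b # y = U_bar c @ v" "w = u @ v"
    unfolding U_supp_eq by blast
  show "w \<in> ?R"
  proof (cases c rule: rev_cases)
    case Nil
    thus ?thesis using * by auto
  next
    case (snoc c' l)
    hence "x = u @ c'" "l = a" "b = (\<not> a)" "y = U_bar c' @ v"
      using * by (auto simp: U_bar_Cons)
    thus ?thesis using * unfolding U_supp_eq by auto
  qed
next
  fix w assume "w \<in> ?R"
  then consider "w = x @ a # b # y" | "a \<noteq> b" "w \<in> U_supp x y"
    by (auto split: if_splits)
  thus "w \<in> U_supp (x @ [a]) (b # y)"
  proof cases
    case 1
    thus ?thesis using append_in_U_supp[of "x @ [a]" "b # y"] by simp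
  next
    case 2
    then obtain u v c where "x = u @ c" "y = U_bar c @ v" "w = u @ v"
      unfolding U_supp_eq by blast
    thus ?thesis using 2(1) unfolding U_supp_eq
      by (intro CollectI exI[of _ u] exI[of _ v] conjI exI[of _ "c @ [a]"]) (auto simp: U_bar_Cons)
  qed
qed

lemma finite_U_supp [simp]: "finite (U_supp x y)"
proof (induction x arbitrary: y rule: rev_induct)
  case (snoc a x)
  thus ?case by (cases y) (auto simp: U_supp_snoc_Cons)
qed simp

lemma sum_wdim_U_supp_le:
  assumes "2 \<le> \<delta>"
  shows "(\<Sum>w\<in>U_supp x y. wdim \<delta> w) \<le> wdim \<delta> x * wdim \<delta> y"
proof (induction x arbitrary: y rule: rev_induct)
  case (snoc a x)
  show ?case
  proof (cases y)
    case (Cons b v)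
    have pos: "0 \<le> wdim \<delta> w" for w using wdim_ge_1[OF assms, of w] by linarith
    show ?thesis
    proof (cases "a = b")
      case True
      thus ?thesis using Cons wdim_mult[OF assms, of x a b v] by (simp add: U_supp_snoc_Cons)
    next
      case False
      \<comment> \<open>Aiming only at an inequality avoids checking that the uncancelled word lies
        outside \<open>U_supp x v\<close>.\<close>
      have "(\<Sum>w\<in>U_supp (x @ [a]) y. wdim \<delta> w)
          \<le> wdim \<delta> (x @ a # b # v) + (\<Sum>w\<in>U_supp x v. wdim \<delta> w)"
        using Cons False pos by (simp add: U_supp_snoc_Cons sum.insert_if)
      also have "\<dots> \<le> wdim \<delta> (x @ a # b # v) + wdim \<delta> x * wdim \<delta> v"
        using snoc by simp
      also have "\<dots> = wdim \<delta> (x @ [a]) * wdim \<delta> y"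
        using False Cons by (simp add: wdim_mult[OF assms])
      finally show ?thesis .
    qed
  qed simp
qed simp

text \<open>Compare the prefix \<open>U_bar d\<close> of \<open>b\<close> that is cancelled by
  \<open>x\<close> with the part \<open>y1\<close> of \<open>b\<close> coming from \<open>y\<close>:
  the cancellation either stays inside \<open>y1\<close>, or uses it up and continues into
  \<open>z1\<close>.\<close>

lemma U_supp_assoc:
  assumes "a \<in> U_supp x b" "b \<in> U_supp y z"
  shows "\<exists>t\<in>U_supp x y. a \<in> U_supp t z"
proof -
  obtain y1 z1 c where b: "b = y1 @ z1" "y = y1 @ c" "z = U_bar c @ z1"
    using assms(2) unfolding U_supp_eq by blast
  obtain x1 b' d where a: "a = x1 @ b'" "x = x1 @ d" "b = U_bar d @ b'"
    using assms(1) unfolding U_supp_eq by blast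
  have "y1 @ z1 = U_bar d @ b'" using a b by simp
  then consider us where "y1 = U_bar d @ us" "b' = us @ z1"
    | us where "U_bar d = y1 @ us" "z1 = us @ b'"
    unfolding append_eq_append_conv2 by metis
  thus ?thesis
  proof cases
    case 1
    have "x1 @ us @ c \<in> U_supp x y" unfolding U_supp_eq using a b 1
      by (intro CollectI exI[of _ x1] exI[of _ "us @ c"] conjI exI[of _ d]) auto
    moreover have "a \<in> U_supp (x1 @ us @ c) z" unfolding U_supp_eq using a b 1
      by (intro CollectI exI[of _ "x1 @ us"] exI[of _ z1] conjI exI[of _ c]) auto
    ultimately show ?thesis by blast
  next
    case 2
    have d: "d = U_bar us @ U_bar y1" using arg_cong[OF 2(1), of U_bar] by simp
    have "x1 @ U_bar us @ c \<in> U_supp x y" unfolding U_supp_eq using a b d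
      by (intro CollectI exI[of _ "x1 @ U_bar us"] exI[of _ c] conjI exI[of _ "U_bar y1"]) auto
    moreover have "a \<in> U_supp (x1 @ U_bar us @ c) z" unfolding U_supp_eq using a b 2
      by (intro CollectI exI[of _ x1] exI[of _ b'] conjI exI[of _ "U_bar us @ c"]) auto
    ultimately show ?thesis by blast
  qed
qed

lemma prod_supp_U_N_Cons:
  "xs \<noteq> [] \<Longrightarrow> prod_supp U_N (x # xs) = (\<Union>b\<in>prod_supp U_N xs. U_supp x b)"
  by (cases xs) (auto simp: U_supp_def)

lemma finite_prod_supp_U_N: "finite (prod_supp U_N xs)"
proof (induction xs)
  case (Cons x xs)
  thus ?case by (cases "xs = []") (simp_all add: prod_supp_U_N_Cons)
qed simp

text \<open>\<open>prod_supp\<close> brackets to the right, so cutting a product in the middle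
  relies on \<open>U_supp_assoc\<close>.\<close>

lemma prod_supp_U_N_append:
  assumes "xs \<noteq> []" "ys \<noteq> []" "a \<in> prod_supp U_N (xs @ ys)"
  shows "\<exists>b\<in>prod_supp U_N xs. \<exists>c\<in>prod_supp U_N ys. a \<in> U_supp b c"
  using assms
proof (induction xs arbitrary: a)
  case (Cons x xs)
  show ?case
  proof (cases "xs = []")
    case True
    thus ?thesis using Cons.prems by (auto simp: prod_supp_U_N_Cons)
  next
    case False
    then obtain b where b: "b \<in> prod_supp U_N (xs @ ys)" "a \<in> U_supp x b"
      using Cons.prems by (auto simp: prod_supp_U_N_Cons)
    obtain p c where p: "p \<in> prod_supp U_N xs" "c \<in> prod_supp U_N ys" "b \<in> U_supp p c"
      using Cons.IH[OF False Cons.prems(2) b(1)] by blast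
    from U_supp_assoc[OF b(2) p(3)] show ?thesis
      using p False by (auto simp: prod_supp_U_N_Cons)
  qed
qed simp

lemma concat_in_prod_supp_U_N: "xs \<noteq> [] \<Longrightarrow> concat xs \<in> prod_supp U_N xs"
proof (induction xs)
  case (Cons x xs)
  thus ?case using append_in_U_supp by (cases "xs = []") (auto simp: prod_supp_U_N_Cons)
qed simp

section \<open>Balls and their sizes\<close>

text \<open>The generating property makes the set under \<open>LEAST\<close> nonempty, so the least
  length is attained.\<close>

lemma mem_ball_X_iff:
  assumes "gen_set bar Nc X"
  shows "a \<in> ball_X e Nc X n \<longleftrightarrow>
    a = e \<or> (\<exists>xs. xs \<noteq> [] \<and> set xs \<subseteq> X \<and> length xs \<le> n \<and> a \<in> prod_supp Nc xs)"
    (is "_ \<longleftrightarrow> a = e \<or> ?R")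
proof (cases "a = e")
  case False
  let ?Q = "\<lambda>n. n \<ge> 1 \<and> (\<exists>xs. set xs \<subseteq> X \<and> length xs = n \<and> a \<in> prod_supp Nc xs)"
  have ex: "\<exists>n. ?Q n"
    using assms unfolding gen_set_def by (metis One_nat_def Suc_leI length_greater_0_conv)
  have "(LEAST n. ?Q n) \<le> n \<longleftrightarrow> ?R"
  proof
    assume "(LEAST n. ?Q n) \<le> n"
    with LeastI_ex[OF ex] show ?R by (metis list.size(3) not_one_le_zero)
  next
    assume ?R
    then obtain xs where xs: "xs \<noteq> []" "set xs \<subseteq> X" "length xs \<le> n" "a \<in> prod_supp Nc xs"
      by blast
    hence "?Q (length xs)" by (auto simp: Suc_le_eq)
    hence "(LEAST n. ?Q n) \<le> length xs" by (rule Least_le)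
    thus "(LEAST n. ?Q n) \<le> n" using xs(3) by linarith
  qed
  thus ?thesis using False by (simp add: ball_X_def word_len_def)
qed (simp add: ball_X_def word_len_def)

lemma finite_ball_X:
  assumes "gen_set bar U_N X"
  shows "finite (ball_X e U_N X n)"
proof (rule finite_subset)
  show "ball_X e U_N X n \<subseteq>
      insert e (\<Union>xs\<in>{xs. set xs \<subseteq> X \<and> length xs \<le> n}. prod_supp U_N xs)"
    using mem_ball_X_iff[OF assms] by blast
  have "finite X" using assms by (simp add: gen_set_def)
  thus "finite (insert e (\<Union>xs\<in>{xs. set xs \<subseteq> X \<and> length xs \<le> n}. prod_supp U_N xs))"
    by (simp add: finite_lists_length_le finite_prod_supp_U_N)
qed

lemma ball_X_add_subset:
  assumes X: "gen_set bar U_N X"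
  shows "ball_X [] U_N X (m + n) \<subseteq> (\<Union>x\<in>ball_X [] U_N X m. \<Union>y\<in>ball_X [] U_N X n. U_supp x y)"
proof
  note iff = mem_ball_X_iff[OF X]
  have Nil: "[] \<in> ball_X [] U_N X k" for k by (simp add: iff)
  fix a assume "a \<in> ball_X [] U_N X (m + n)"
  \<comment> \<open>The unit, products of at most \<open>m\<close> factors and the case
    \<open>m = 0\<close> allow no cut into two nonempty parts; they are paired with the empty
    word.\<close>
  then consider "a \<in> ball_X [] U_N X m" | "a \<in> ball_X [] U_N X n"
    | xs where "set xs \<subseteq> X" "length xs \<le> m + n" "m < length xs" "m \<noteq> 0" "a \<in> prod_supp U_N xs"
    unfolding iff by (metis add_0 not_le)
  thus "a \<in> (\<Union>x\<in>ball_X [] U_N X m. \<Union>y\<in>ball_X [] U_N X n. U_supp x y)"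
  proof cases
    case 1
    show ?thesis by (rule UN_I[OF 1], rule UN_I[OF Nil]) simp
  next
    case 2
    show ?thesis by (rule UN_I[OF Nil], rule UN_I[OF 2]) simp
  next
    case 3
    have ne: "take m xs \<noteq> []" "drop m xs \<noteq> []" using 3 by auto
    obtain b c where bc: "b \<in> prod_supp U_N (take m xs)" "c \<in> prod_supp U_N (drop m xs)"
        "a \<in> U_supp b c"
      using prod_supp_U_N_append[OF ne, of a] 3(5) by auto
    have "b \<in> ball_X [] U_N X m" unfolding iff
      using ne bc 3 set_take_subset[of m xs] by (intro disjI2 exI[of _ "take m xs"]) auto
    moreover have "c \<in> ball_X [] U_N X n" unfolding iff
      using ne bc 3 set_drop_subset[of m xs] by (intro disjI2 exI[of _ "drop m xs"]) auto
    ultimately show ?thesis using bc(3) by blast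
  qed
qed

lemma sum_squares_le_square_sum:
  fixes f :: "'a \<Rightarrow> real"
  assumes "finite A" "\<And>a. a \<in> A \<Longrightarrow> 0 \<le> f a"
  shows "(\<Sum>a\<in>A. (f a)\<^sup>2) \<le> (\<Sum>a\<in>A. f a)\<^sup>2"
proof -
  have "(\<Sum>a\<in>A. (f a)\<^sup>2) \<le> (\<Sum>a\<in>A. f a * sum f A)"
    using assms by (intro sum_mono) (auto simp: power2_eq_square intro!: mult_left_mono member_le_sum)
  thus ?thesis by (simp add: sum_distrib_right power2_eq_square)
qed

text \<open>Every word of the large ball occurs in some product of \<open>x\<close> and
  \<open>y\<close> from the small ones. For fixed \<open>x\<close>, \<open>y\<close> the squared
  dimensions sum to at most the square of the sum, hence to at most (d(x) d(y))^2.\<close>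

lemma set_size_ball_X_add_le:
  assumes X: "gen_set bar U_N X" and "2 \<le> \<delta>"
  shows "set_size (wdim \<delta>) (ball_X [] U_N X (m + n)) \<le>
    set_size (wdim \<delta>) (ball_X [] U_N X m) * set_size (wdim \<delta>) (ball_X [] U_N X n)"
proof -
  let ?B = "ball_X [] U_N X"
  let ?S = "SIGMA p:?B m \<times> ?B n. U_supp (fst p) (snd p)"
  have fin: "finite (?B k)" for k by (rule finite_ball_X[OF X])
  have pos: "0 \<le> wdim \<delta> w" for w using wdim_ge_1[OF assms(2), of w] by linarith
  have finS: "finite ?S" using fin by simp
  have "?B (m + n) \<subseteq> snd ` ?S"
  proof
    fix a assume "a \<in> ?B (m + n)"
    then obtain x y where "x \<in> ?B m" "y \<in> ?B n" "a \<in> U_supp x y"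
      using ball_X_add_subset[OF X] by blast
    hence "((x, y), a) \<in> ?S" by auto
    thus "a \<in> snd ` ?S" by force
  qed
  hence "set_size (wdim \<delta>) (?B (m + n)) \<le> (\<Sum>a\<in>snd ` ?S. (wdim \<delta> a)\<^sup>2)"
    unfolding set_size_def using finS by (intro sum_mono2) auto
  also have "\<dots> \<le> (\<Sum>s\<in>?S. (wdim \<delta> (snd s))\<^sup>2)"
    using sum_image_le[OF finS, of "\<lambda>a. (wdim \<delta> a)\<^sup>2" snd] by (simp add: comp_def)
  also have "\<dots> = (\<Sum>p\<in>?B m \<times> ?B n. \<Sum>a\<in>U_supp (fst p) (snd p). (wdim \<delta> a)\<^sup>2)"
    using fin by (subst sum.Sigma) (auto simp: case_prod_unfold)
  also have "\<dots> \<le> (\<Sum>p\<in>?B m \<times> ?B n. (wdim \<delta> (fst p))\<^sup>2 * (wdim \<delta> (snd p))\<^sup>2)"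
  proof (rule sum_mono)
    fix p
    have "(\<Sum>a\<in>U_supp (fst p) (snd p). (wdim \<delta> a)\<^sup>2) \<le> (\<Sum>a\<in>U_supp (fst p) (snd p). wdim \<delta> a)\<^sup>2"
      by (rule sum_squares_le_square_sum) (auto simp: pos)
    also have "\<dots> \<le> (wdim \<delta> (fst p) * wdim \<delta> (snd p))\<^sup>2"
      by (intro power_mono sum_wdim_U_supp_le assms sum_nonneg pos)
    finally show "(\<Sum>a\<in>U_supp (fst p) (snd p). (wdim \<delta> a)\<^sup>2)
        \<le> (wdim \<delta> (fst p))\<^sup>2 * (wdim \<delta> (snd p))\<^sup>2"
      by (simp add: power_mult_distrib)
  qed
  also have "\<dots> = set_size (wdim \<delta>) (?B m) * set_size (wdim \<delta>) (?B n)"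
    by (simp add: set_size_def sum_product sum.cartesian_product case_prod_unfold)
  finally show ?thesis .
qed

text \<open>The \<open>lim\<close> in \<open>omega_X\<close> carries information only once
  convergence is known; submultiplicativity gives it, and the unit in every ball gives the lower
  bound 1.\<close>

lemma omega_X_limit:
  assumes X: "gen_set bar U_N X" and "2 \<le> \<delta>"
  shows "(\<lambda>n. set_size (wdim \<delta>) (ball_X [] U_N X n) powr (1 / real n))
    \<longlonglongrightarrow> omega_X [] U_N (wdim \<delta>) X"
proof -
  have "1 \<le> set_size (wdim \<delta>) (ball_X [] U_N X n)" for n
  proof -
    have "(wdim \<delta> [])\<^sup>2 \<le> set_size (wdim \<delta>) (ball_X [] U_N X n)"
      unfolding set_size_def
      by (rule member_le_sum) (auto simp: mem_ball_X_iff[OF X] finite_ball_X[OF X])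
    thus ?thesis by simp
  qed
  from submultiplicative_root_convergent[OF set_size_ball_X_add_le[OF assms] this]
  show ?thesis unfolding omega_X_def by (simp add: convergent_LIMSEQ_iff)
qed

section \<open>Free pairs in a generating set\<close>

text \<open>A grading of the fusion algebra by the integers: cancelled letters are conjugate and
  have opposite degrees.\<close>

definition udeg :: "uword \<Rightarrow> int" where
  "udeg w = sum_list (map (\<lambda>b. if b then 1 else - 1) w)"

lemma udeg_simps [simp]:
  "udeg [] = 0" "udeg (b # x) = (if b then 1 else - 1) + udeg x"
  "udeg (x @ y) = udeg x + udeg y"
  by (simp_all add: udeg_def)

lemma udeg_U_bar [simp]: "udeg (U_bar x) = - udeg x"
  by (induction x) (auto simp: U_bar_Cons)

lemma udeg_U_supp: "w \<in> U_supp x y \<Longrightarrow> udeg w = udeg x + udeg y"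
  unfolding U_supp_eq by auto

lemma udeg_prod_supp_eq_0:
  assumes "\<And>x. x \<in> set xs \<Longrightarrow> udeg x = 0" "a \<in> prod_supp U_N xs"
  shows "udeg a = 0"
  using assms
proof (induction xs arbitrary: a)
  case (Cons x xs)
  show ?case
  proof (cases "xs = []")
    case False
    then obtain b where b: "b \<in> prod_supp U_N xs" "a \<in> U_supp x b"
      using Cons.prems by (auto simp: prod_supp_U_N_Cons)
    have "udeg b = 0" by (rule Cons.IH[OF _ b(1)]) (use Cons.prems(1) in simp)
    thus ?thesis using Cons.prems(1)[of x] udeg_U_supp[OF b(2)] by simp
  qed (use Cons.prems in auto)
qed simp

text \<open>Generators of degree 0 produce only words of degree 0, whereas \<open>[True]\<close> has
  degree 1.\<close>

lemma gen_set_ex_udeg: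
  assumes "gen_set U_bar U_N X"
  shows "\<exists>x\<in>X. udeg x \<noteq> 0"
proof (rule ccontr)
  assume "\<not> (\<exists>x\<in>X. udeg x \<noteq> 0)"
  moreover obtain xs where "set xs \<subseteq> X" "[True] \<in> prod_supp U_N xs"
    using assms unfolding gen_set_def by blast
  ultimately have "udeg [True] = 0" using udeg_prod_supp_eq_0[of xs "[True]"] by blast
  thus False by simp
qed

section \<open>Alternating words and substitutions\<close>

lemma not_successively_neq:
  "\<not> successively (\<noteq>) x \<Longrightarrow> \<exists>u a v. x = u @ a # a # v"
proof (induction x rule: induct_list012)
  case (3 a b x)
  show ?case
  proof (cases "a = b")
    case True
    thus ?thesis by (intro exI[of _ "[]"]) auto
  next
    case False
    then obtain u c v where "b # x = u @ c # c # v" using 3 by auto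
    thus ?thesis by (intro exI[of _ "a # u"]) auto
  qed
qed auto

lemma successively_U_bar: "successively (\<noteq>) (U_bar x) = successively (\<noteq>) x"
  by (simp add: U_bar_def successively_rev successively_map eq_commute)

lemma udeg_alternating:
  "successively (\<noteq>) x \<Longrightarrow> x \<noteq> [] \<Longrightarrow>
    udeg x = (if hd x = last x then if hd x then 1 else - 1 else 0)"
  by (induction x rule: induct_list012) (auto split: if_splits)

text \<open>A code whose words are distinct, nonempty and of equal length is uniquely
  decodable.\<close>

lemma inj_concat_map:
  assumes "inj g" "\<And>a b. length (g a) = length (g b)" "\<And>a. g a \<noteq> []"
  shows "inj (\<lambda>w. concat (map g w))"
proof (rule injI)
  fix v w assume "concat (map g v) = concat (map g w)"
  thus "v = w"
  proof (induction v w rule: list_induct2')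
    case (4 a v b w)
    have "g a = g b" "concat (map g v) = concat (map g w)"
      using 4(2) assms(2)[of a b] by simp_all
    thus ?case using 4(1) injD[OF assms(1)] by simp
  qed (simp_all add: assms(3))
qed

section \<open>Lower bounds for the dimensions of substituted words\<close>

context
  fixes \<delta> :: real
  assumes delta_ge_2: "2 \<le> \<delta>"
begin

text \<open>By \<open>wdim_break\<close> the dimension factors at a repeated letter inside each
  \<open>x\<close>. All resulting pieces are nonempty and so have dimension at least \<delta>; the
  induction takes \<open>a # v\<close> as the new \<open>z\<close>.\<close>

lemma power_le_wdim_append_concat:
  assumes "\<And>x. x \<in> set xs \<Longrightarrow> \<exists>u a v. x = u @ a # a # v" "z \<noteq> []"
  shows "\<delta> ^ Suc (length xs) \<le> wdim \<delta> (z @ concat xs)"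
  using assms
proof (induction xs arbitrary: z)
  case Nil
  thus ?case using wdim_ge_delta[OF delta_ge_2] by simp
next
  case (Cons x xs)
  obtain u a v where x: "x = u @ a # a # v" using Cons.prems(1)[of x] by auto
  have "\<delta> * \<delta> ^ Suc (length xs) \<le> wdim \<delta> ((z @ u) @ [a]) * wdim \<delta> ((a # v) @ concat xs)"
    using delta_ge_2 wdim_ge_1[OF delta_ge_2, of "z @ u @ [a]"]
    by (intro mult_mono Cons.IH wdim_ge_delta) (auto intro: Cons.prems)
  also have "\<dots> = wdim \<delta> (z @ concat (x # xs))"
    using wdim_break[OF delta_ge_2, of "z @ u" a "v @ concat xs"] x by simp
  finally show ?case by simp
qed

lemma power_le_wdim_concat:
  assumes "\<And>x. x \<in> set xs \<Longrightarrow> \<exists>u a v. x = u @ a # a # v"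
  shows "\<delta> ^ length xs \<le> wdim \<delta> (concat xs)"
proof (cases xs)
  case (Cons x ys)
  obtain u a v where x: "x = u @ a # a # v" using assms[of x] Cons by auto
  have "1 * \<delta> ^ Suc (length ys) \<le> wdim \<delta> (u @ [a]) * wdim \<delta> ((a # v) @ concat ys)"
    using delta_ge_2 wdim_ge_1[OF delta_ge_2, of "u @ [a]"] assms Cons
    by (intro mult_mono power_le_wdim_append_concat) auto
  also have "\<dots> = wdim \<delta> (concat xs)"
    using wdim_break[OF delta_ge_2, of u a "v @ concat ys"] x Cons by simp
  finally show ?thesis using Cons by simp
qed simp

text \<open>Along an alternating word the dimensions satisfy f(k+2) = \<delta>f(k+1) - f(k), which
  is convex for \<delta> \<ge> 2. The second claim compares the first and the last
  increment.\<close>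

lemma wdim_alternating_append:
  assumes "successively (\<noteq>) x" "x \<noteq> []"
  shows "wdim \<delta> (last x # v) \<le> wdim \<delta> (x @ v) \<and>
    wdim \<delta> (last x # v) - wdim \<delta> v \<le> wdim \<delta> (x @ v) - wdim \<delta> (tl x @ v)"
  using assms
proof (induction x rule: induct_list012)
  case (3 a b x)
  let ?d = "wdim \<delta> (b # x @ v)"
  have IH: "wdim \<delta> (last (b # x) # v) \<le> ?d"
    "wdim \<delta> (last (b # x) # v) - wdim \<delta> v \<le> ?d - wdim \<delta> (x @ v)"
    using 3 by auto
  have "2 * ?d \<le> \<delta> * ?d"
    using delta_ge_2 wdim_ge_1[OF delta_ge_2, of "b # x @ v"] by (intro mult_right_mono) auto
  moreover have "wdim \<delta> (x @ v) \<le> ?d" by (rule wdim_le_Cons[OF delta_ge_2])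
  moreover have "wdim \<delta> (a # b # x @ v) = \<delta> * ?d - wdim \<delta> (x @ v)"
    using 3 by simp
  ultimately show ?case using IH by simp
qed auto

text \<open>Values alone do not carry the induction, since the recursion subtracts the dimension of
  the tail. Increments do: \<delta>y - z = (\<delta> - 1)y + (y - z).\<close>

lemma wdim_le_wdim_concat_map_alternating:
  assumes g: "\<And>a. successively (\<noteq>) (g a)" "\<And>a. g a \<noteq> []"
    "\<And>a. hd (g a) = a" "\<And>a. last (g a) = a"
  shows "wdim \<delta> w \<le> wdim \<delta> (concat (map g w)) \<and>
    (w \<noteq> [] \<longrightarrow> wdim \<delta> w - wdim \<delta> (tl w)
        \<le> wdim \<delta> (concat (map g w)) - wdim \<delta> (tl (concat (map g w))))"
proof (induction w rule: induct_list012)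
  case (2 a)
  show ?case using wdim_alternating_append[OF g(1,2), of a "[]"] g(4) by simp
next
  case (3 a b w)
  let ?v = "concat (map g (b # w))"
  \<comment> \<open>The image of \<open>b # w\<close> again begins with \<open>b\<close>, so
    prepending \<open>a\<close> falls under the same case of \<open>wdim\<close> on both
    sides.\<close>
  have v: "?v = b # tl ?v" using g(2,3)[of b] by (cases "g b") auto
  have IH: "wdim \<delta> (b # w) \<le> wdim \<delta> ?v"
    "wdim \<delta> (b # w) - wdim \<delta> w \<le> wdim \<delta> ?v - wdim \<delta> (tl ?v)"
    using 3(2) by auto
  have "wdim \<delta> (a # ?v) = \<delta> * wdim \<delta> ?v - (if a \<noteq> b then wdim \<delta> (tl ?v) else 0)"
    by (subst (1 2) v) simp
  moreover have "wdim \<delta> (a # ?v) \<le> wdim \<delta> (concat (map g (a # b # w)))"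
    "wdim \<delta> (a # ?v) - wdim \<delta> ?v
      \<le> wdim \<delta> (concat (map g (a # b # w))) - wdim \<delta> (tl (concat (map g (a # b # w))))"
    using wdim_alternating_append[OF g(1,2), of a ?v] g(2,4)[of a] by auto
  moreover have "(\<delta> - 2) * wdim \<delta> (b # w) \<le> (\<delta> - 2) * wdim \<delta> ?v"
    using IH(1) delta_ge_2 by (intro mult_left_mono) auto
  ultimately show ?case using IH by (auto simp: algebra_simps)
qed simp

text \<open>If \<open>x\<close> alternates, nonzero degree forces equal first and last letters, so substitution
  stretches every block; otherwise every factor contributes at least \<open>\<delta>\<close> to the dimension, and
  \<open>\<delta> ^ length w\<close> dominates the dimension of \<open>w\<close>.\<close>
lemma set_size_words_le_set_size_ball:
  assumes X: "gen_set U_bar U_N X"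
  shows "set_size (wdim \<delta>) {w. length w \<le> n} \<le> set_size (wdim \<delta>) (ball_X [] U_N X n)"
proof -
  obtain x where x: "x \<in> X" "udeg x \<noteq> 0" using gen_set_ex_udeg[OF X] by blast
  \<comment> \<open>The letter sent to \<open>x\<close> is the first letter of \<open>x\<close>; if
    \<open>x\<close> also ends with it, each \<open>g a\<close> begins and ends with
    \<open>a\<close>.\<close>
  define g where "g b = (if b = hd x then x else U_bar x)" for b
  define h where "h w = concat (map g w)" for w
  have "udeg (U_bar x) \<noteq> udeg x" using x(2) by simp
  hence neq: "U_bar x \<noteq> x" by metis
  have ne: "x \<noteq> []" using x(2) by auto
  hence gne: "g a \<noteq> []" for a using length_U_bar[of x] by (auto simp: g_def simp del: length_U_bar)
  have gX: "g a \<in> X" for a using x(1) X by (auto simp: g_def gen_set_def)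
  have "inj g" by (rule injI) (use neq in \<open>auto simp: g_def split: if_splits\<close>)
  hence inj: "inj h" unfolding h_def
    by (rule inj_concat_map) (use gne in \<open>auto simp: g_def\<close>)
  have alt: "successively (\<noteq>) (g a) = successively (\<noteq>) x" for a
    using successively_U_bar[of x] by (auto simp: g_def)
  have dim: "wdim \<delta> w \<le> wdim \<delta> (h w)" for w
  proof (cases "successively (\<noteq>) x")
    case True
    hence "hd x = last x" using x(2) ne udeg_alternating[of x] by (auto split: if_splits)
    hence "hd (g a) = a \<and> last (g a) = a" for a
      using ne by (auto simp: g_def U_bar_def hd_rev last_rev hd_map last_map)
    thus ?thesis using wdim_le_wdim_concat_map_alternating[of g w] gne alt True
      unfolding h_def by blast
  next
    case False
    have "\<exists>u c v. y = u @ c # c # v" if "y \<in> set (map g w)" for y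
      using that not_successively_neq[of y] alt False by auto
    from power_le_wdim_concat[of "map g w", OF this] have "\<delta> ^ length w \<le> wdim \<delta> (h w)"
      by (simp add: h_def)
    thus ?thesis using wdim_le_power[OF delta_ge_2, of w] by linarith
  qed
  have sub: "h ` {w. length w \<le> n} \<subseteq> ball_X [] U_N X n"
  proof
    fix v assume "v \<in> h ` {w. length w \<le> n}"
    then obtain w where w: "v = h w" "length w \<le> n" by auto
    show "v \<in> ball_X [] U_N X n"
    proof (cases "w = []")
      case False
      have "h w \<in> prod_supp U_N (map g w)"
        unfolding h_def by (rule concat_in_prod_supp_U_N) (use False in simp)
      thus ?thesis unfolding mem_ball_X_iff[OF X] using w False gX
        by (intro disjI2 exI[of _ "map g w"]) auto
    qed (simp add: w h_def mem_ball_X_iff[OF X])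
  qed
  have "set_size (wdim \<delta>) {w. length w \<le> n} \<le> (\<Sum>w\<in>{w. length w \<le> n}. (wdim \<delta> (h w))\<^sup>2)"
    unfolding set_size_def
  proof (intro sum_mono power_mono dim)
    show "0 \<le> wdim \<delta> w" for w using wdim_ge_1[OF delta_ge_2, of w] by linarith
  qed
  also have "\<dots> = set_size (wdim \<delta>) (h ` {w. length w \<le> n})"
    unfolding set_size_def using inj by (subst sum.reindex) (auto simp: inj_on_def)
  also have "\<dots> \<le> set_size (wdim \<delta>) (ball_X [] U_N X n)"
    unfolding set_size_def using sub finite_ball_X[OF X] by (intro sum_mono2) auto
  finally show ?thesis .
qed

end

section \<open>Growth with respect to the fundamental generators\<close>

lemma length_U_supp: "w \<in> U_supp x y \<Longrightarrow> length w \<le> length x + length y"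
  unfolding U_supp_eq by auto

lemma length_prod_supp_letters:
  "set xs \<subseteq> {[True], [False]} \<Longrightarrow> a \<in> prod_supp U_N xs \<Longrightarrow> length a \<le> length xs"
proof (induction xs arbitrary: a)
  case (Cons x xs)
  show ?case
  proof (cases "xs = []")
    case False
    then obtain b where b: "b \<in> prod_supp U_N xs" "a \<in> U_supp x b"
      using Cons.prems by (auto simp: prod_supp_U_N_Cons)
    have "length b \<le> length xs" by (rule Cons.IH[OF _ b(1)]) (use Cons.prems in simp)
    moreover have "length x = 1" using Cons.prems by auto
    ultimately show ?thesis using length_U_supp[OF b(2)] by simp
  qed (use Cons.prems in auto)
qed simp

lemma word_in_prod_supp_letters: "w \<noteq> [] \<Longrightarrow> w \<in> prod_supp U_N (map (\<lambda>b. [b]) w)"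
  using concat_in_prod_supp_U_N[of "map (\<lambda>b. [b]) w"] by simp

lemma gen_set_letters: "gen_set U_bar U_N {[True], [False]}"
  unfolding gen_set_def
proof (intro conjI allI)
  show "U_bar ` {[True], [False]} = {[True], [False]}" by (auto simp: U_bar_def)
  fix w :: uword
  show "\<exists>xs. xs \<noteq> [] \<and> set xs \<subseteq> {[True], [False]} \<and> w \<in> prod_supp U_N xs"
  proof (cases "w = []")
    case True
    \<comment> \<open>\<open>gen_set\<close> asks for a nonempty product even for the unit; full
      cancellation of two conjugate letters provides one.\<close>
    have "[] \<in> U_supp ([] @ [True]) (False # [])" by (subst U_supp_snoc_Cons) simp
    thus ?thesis using True
      by (intro exI[of _ "[[True], [False]]"]) (simp add: U_supp_def)
  next
    case False
    thus ?thesis using word_in_prod_supp_letters[of w]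
      by (intro exI[of _ "map (\<lambda>b. [b]) w"]) auto
  qed
qed simp

lemma ball_X_letters: "ball_X [] U_N {[True], [False]} n = {w. length w \<le> n}"
proof (intro set_eqI iffI)
  fix w assume "w \<in> ball_X [] U_N {[True], [False]} n"
  thus "w \<in> {w. length w \<le> n}"
    unfolding mem_ball_X_iff[OF gen_set_letters] using length_prod_supp_letters by fastforce
next
  fix w :: uword assume "w \<in> {w. length w \<le> n}"
  thus "w \<in> ball_X [] U_N {[True], [False]} n"
    unfolding mem_ball_X_iff[OF gen_set_letters] using word_in_prod_supp_letters[of w]
    by (cases "w = []") (auto intro!: exI[of _ "map (\<lambda>b. [b]) w"])
qed

lemma finite_words_eq: "finite {w :: uword. length w = n}"
  using finite_lists_length_eq[of "UNIV :: bool set" n] by simp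

lemma sum_words_Suc:
  "(\<Sum>w | length w = Suc n. f w) = (\<Sum>w | length w = n. f (True # w) + f (False # w))"
    for f :: "uword \<Rightarrow> 'a :: comm_monoid_add"
proof -
  have "{w :: uword. length w = Suc n}
      = (#) True ` {w. length w = n} \<union> (#) False ` {w. length w = n}"
    by (auto simp: length_Suc_conv image_iff)
  hence "(\<Sum>w | length w = Suc n. f w)
      = sum f ((#) True ` {w. length w = n}) + sum f ((#) False ` {w. length w = n})"
    using finite_words_eq[of n] by (simp, subst sum.union_disjoint) auto
  thus ?thesis by (simp add: sum.reindex sum.distrib)
qed

lemma set_size_words_le:
  "set_size d {w :: uword. length w \<le> n} = (\<Sum>k\<le>n. \<Sum>w | length w = k. (d w)\<^sup>2)"
proof -
  have "{w :: uword. length w \<le> n} = (\<Union>k\<in>{..n}. {w. length w = k})" by auto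
  thus ?thesis unfolding set_size_def
    using sum.UNION_disjoint[of "{..n}" "\<lambda>k. {w :: uword. length w = k}" "\<lambda>w. (d w)\<^sup>2"]
      finite_words_eq by fastforce
qed

text \<open>The sums of \<open>x\<^sup>2\<close>, \<open>x y\<close>, \<open>y\<^sup>2\<close>, where \<open>x\<close> and \<open>y\<close> are the dimensions of a word and its tail,
  over all words of given length evolve by a linear map with characteristic polynomial \<open>P_q\<close>.
  This is its left eigenvector for the eigenvalue \<open>r\<close>.\<close>
definition eigenform :: "real \<Rightarrow> real \<Rightarrow> real \<Rightarrow> real \<Rightarrow> real" where
  "eigenform \<delta> r x y = x\<^sup>2 - 2 * \<delta> / (r + 1) * (x * y) + y\<^sup>2 / r"

text \<open>The two terms belong to prepending a different and an equal letter. The coefficients of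
  \<open>x * y\<close> and \<open>y\<^sup>2\<close> agree for every \<open>r\<close>; for
  \<open>x\<^sup>2\<close>, multiplying by \<open>r * (r + 1)\<close> turns the condition into the
  cubic.\<close>

lemma eigenform_step:
  assumes r: "r ^ 3 - (2 * \<delta>\<^sup>2 - 1) * r\<^sup>2 + (2 * \<delta>\<^sup>2 - 2) * r - 2 = 0" "0 < r"
  shows "eigenform \<delta> r (\<delta> * x - y) x + eigenform \<delta> r (\<delta> * x) x = r * eigenform \<delta> r x y"
proof -
  have nz: "r + 1 \<noteq> 0" "r \<noteq> 0" using r(2) by auto
  have "r * (r + 1) * (2 * \<delta>\<^sup>2 - 4 * \<delta>\<^sup>2 / (r + 1) + 2 / r - r)
      = - (r ^ 3 - (2 * \<delta>\<^sup>2 - 1) * r\<^sup>2 + (2 * \<delta>\<^sup>2 - 2) * r - 2)"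
    using nz by (simp add: divide_simps) algebra
  hence "2 * \<delta>\<^sup>2 - 4 * \<delta>\<^sup>2 / (r + 1) + 2 / r - r = 0" using r nz by simp
  moreover have "eigenform \<delta> r (\<delta> * x - y) x + eigenform \<delta> r (\<delta> * x) x - r * eigenform \<delta> r x y
      = (2 * \<delta>\<^sup>2 - 4 * \<delta>\<^sup>2 / (r + 1) + 2 / r - r) * x\<^sup>2"
    unfolding eigenform_def using nz by (simp add: divide_simps) algebra
  ultimately show ?thesis by simp
qed

lemma eigenform_bounds:
  assumes "0 \<le> y" "y \<le> x" "1 \<le> r" "0 \<le> \<delta>"
  shows "(1 - 2 * \<delta> / (r + 1)) * x\<^sup>2 \<le> eigenform \<delta> r x y" "eigenform \<delta> r x y \<le> 2 * x\<^sup>2"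
proof -
  have "2 * \<delta> / (r + 1) * (x * y) \<le> 2 * \<delta> / (r + 1) * x\<^sup>2"
    using assms by (intro mult_left_mono) (auto simp: power2_eq_square mult_left_mono)
  moreover have "0 \<le> y\<^sup>2 / r" using assms by simp
  ultimately show "(1 - 2 * \<delta> / (r + 1)) * x\<^sup>2 \<le> eigenform \<delta> r x y"
    unfolding eigenform_def by (simp add: left_diff_distrib)
  have "y\<^sup>2 / r \<le> y\<^sup>2 / 1" using assms by (intro divide_left_mono) auto
  also have "\<dots> \<le> x\<^sup>2" using assms by (simp add: power_mono)
  moreover have "0 \<le> 2 * \<delta> / (r + 1) * (x * y)" using assms by simp
  ultimately show "eigenform \<delta> r x y \<le> 2 * x\<^sup>2" unfolding eigenform_def by linarith
qed

section \<open>Exponential growth rate of spheres and balls\<close>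

context
  fixes \<delta> r :: real
  assumes delta_ge_2: "2 \<le> \<delta>"
    and r_root: "r ^ 3 - (2 * \<delta>\<^sup>2 - 1) * r\<^sup>2 + (2 * \<delta>\<^sup>2 - 2) * r - 2 = 0"
    and r_gt: "2 * \<delta>\<^sup>2 - 2 < r"
begin

text \<open>Makes the constant \<open>1 - 2 * \<delta> / (r + 1)\<close> from
  \<open>eigenform_bounds\<close> positive.\<close>

lemma r_gt_2_delta: "2 * \<delta> < r"
proof -
  have "2 * \<delta> \<le> \<delta>\<^sup>2" using delta_ge_2 by (simp add: power2_eq_square)
  thus ?thesis using r_gt delta_ge_2 by linarith
qed

text \<open>A nonempty word has one extension of each kind in \<open>eigenform_step\<close>, so the
  sum is multiplied by \<open>r\<close>. The start is length 1, because both extensions of the empty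
  word have dimension \<delta>.\<close>

lemma sum_eigenform:
  "(\<Sum>w | length w = Suc n. eigenform \<delta> r (wdim \<delta> w) (wdim \<delta> (tl w))) =
    2 * eigenform \<delta> r \<delta> 1 * r ^ n"
proof (induction n)
  case 0
  show ?case unfolding sum_words_Suc by simp
next
  case (Suc n)
  have r: "0 < r" using r_gt_2_delta delta_ge_2 by linarith
  have step: "eigenform \<delta> r (wdim \<delta> (True # w)) (wdim \<delta> w)
      + eigenform \<delta> r (wdim \<delta> (False # w)) (wdim \<delta> w)
      = r * eigenform \<delta> r (wdim \<delta> w) (wdim \<delta> (tl w))" if "w \<noteq> []" for w
    using eigenform_step[OF r_root r, of "wdim \<delta> w" "wdim \<delta> (tl w)"] that
    by (cases w) (auto simp: add.commute)
  have "(\<Sum>w | length w = Suc (Suc n). eigenform \<delta> r (wdim \<delta> w) (wdim \<delta> (tl w)))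
      = (\<Sum>w | length w = Suc n. r * eigenform \<delta> r (wdim \<delta> w) (wdim \<delta> (tl w)))"
    by (subst sum_words_Suc, rule sum.cong) (auto intro!: step)
  also have "\<dots> = r * (2 * eigenform \<delta> r \<delta> 1 * r ^ n)"
    by (subst sum_distrib_left[symmetric], subst Suc) simp
  finally show ?case by (simp add: mult_ac)
qed

lemma sphere_size_bounds:
  "\<exists>c C. 0 < c \<and> 0 < C \<and>
    (\<forall>n. c * r ^ n \<le> (\<Sum>w | length w = n. (wdim \<delta> w)\<^sup>2) \<and>
         (\<Sum>w | length w = n. (wdim \<delta> w)\<^sup>2) \<le> C * r ^ n)"
proof -
  have r: "1 < r" using r_gt_2_delta delta_ge_2 by linarith
  define s where "s n = (\<Sum>w | length w = n. (wdim \<delta> w)\<^sup>2)" for n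
  define K where "K = 2 * eigenform \<delta> r \<delta> 1"
  define k where "k = 1 - 2 * \<delta> / (r + 1)"
  have k: "0 < k" using r_gt_2_delta r by (simp add: k_def divide_simps)
  have b: "k * (wdim \<delta> w)\<^sup>2 \<le> eigenform \<delta> r (wdim \<delta> w) (wdim \<delta> (tl w))"
    "eigenform \<delta> r (wdim \<delta> w) (wdim \<delta> (tl w)) \<le> 2 * (wdim \<delta> w)\<^sup>2" for w
  proof -
    have "wdim \<delta> (tl w) \<le> wdim \<delta> w"
      using wdim_le_Cons[OF delta_ge_2] by (cases w) auto
    moreover have "0 \<le> wdim \<delta> (tl w)" using wdim_ge_1[OF delta_ge_2, of "tl w"] by linarith
    ultimately show "k * (wdim \<delta> w)\<^sup>2 \<le> eigenform \<delta> r (wdim \<delta> w) (wdim \<delta> (tl w))"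
      "eigenform \<delta> r (wdim \<delta> w) (wdim \<delta> (tl w)) \<le> 2 * (wdim \<delta> w)\<^sup>2"
      using eigenform_bounds r delta_ge_2 unfolding k_def by auto
  qed
  \<comment> \<open>\<open>K / 2\<close> is the value of the form at a one-letter word, where the
    lower bound is positive.\<close>
  have K: "0 < K"
  proof -
    have "0 < k * \<delta>\<^sup>2" using k delta_ge_2 by simp
    thus ?thesis using b(1)[of "[True]"] by (simp add: K_def)
  qed
  have up: "k * s (Suc n) \<le> K * r ^ n" for n
    unfolding s_def K_def sum_eigenform[symmetric] sum_distrib_left by (intro sum_mono b)
  have lo: "K * r ^ n \<le> 2 * s (Suc n)" for n
    unfolding s_def K_def sum_eigenform[symmetric] sum_distrib_left by (intro sum_mono b)
  have s0: "s 0 = 1" by (simp add: s_def)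
  \<comment> \<open>Dividing by \<open>r\<close> undoes the index shift in
    \<open>sum_eigenform\<close>; the comparison with 1 covers the empty word, as
    \<open>s 0 = 1\<close>.\<close>
  define c where "c = min 1 (K / (2 * r))"
  define C where "C = max 1 (K / (k * r))"
  have "c * r ^ n \<le> s n \<and> s n \<le> C * r ^ n" for n
  proof (cases n)
    case 0
    thus ?thesis by (simp add: s0 c_def C_def)
  next
    case (Suc m)
    have "c * r ^ n \<le> K / (2 * r) * r ^ n"
      using r by (intro mult_right_mono) (auto simp: c_def)
    also have "\<dots> \<le> s n" using lo[of m] Suc r by (simp add: field_simps)
    finally have "c * r ^ n \<le> s n" .
    moreover have "s n \<le> K / (k * r) * r ^ n"
      using up[of m] Suc r k by (simp add: field_simps)
    moreover have "K / (k * r) * r ^ n \<le> C * r ^ n"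
      using r by (intro mult_right_mono) (auto simp: C_def)
    ultimately show ?thesis by linarith
  qed
  moreover have "0 < c" "0 < C" using K r k by (auto simp: c_def C_def)
  ultimately show ?thesis unfolding s_def by blast
qed

text \<open>The ball lies between c r^n and (n + 1) C r^n, and the n-th roots of the remaining
  factors tend to 1.\<close>

lemma words_size_root_limit:
  "(\<lambda>n. set_size (wdim \<delta>) {w. length w \<le> n} powr (1 / real n)) \<longlonglongrightarrow> r"
proof -
  define s where "s n = (\<Sum>w | length w = n. (wdim \<delta> w)\<^sup>2)" for n
  define S where "S n = set_size (wdim \<delta>) {w. length w \<le> n}" for n
  have r: "1 < r" using r_gt_2_delta delta_ge_2 by linarith
  obtain c C where cC: "0 < c" "0 < C" "\<And>n. c * r ^ n \<le> s n" "\<And>n. s n \<le> C * r ^ n"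
    using sphere_size_bounds unfolding s_def by blast
  have S: "S n = (\<Sum>k\<le>n. s k)" for n by (simp add: S_def s_def set_size_words_le)
  have s0: "0 \<le> s k" for k by (simp add: s_def sum_nonneg)
  have lo: "c * r ^ n \<le> S n" for n
  proof -
    have "s n \<le> S n" unfolding S using s0 by (intro member_le_sum) auto
    thus ?thesis using cC(3)[of n] by linarith
  qed
  have up: "S n \<le> (real n + 1) * C * r ^ n" for n
  proof -
    have "s k \<le> C * r ^ n" if "k \<le> n" for k
    proof -
      have "C * r ^ k \<le> C * r ^ n" using that cC(2) r by (intro mult_left_mono power_increasing) auto
      thus ?thesis using cC(4)[of k] by linarith
    qed
    hence "S n \<le> (\<Sum>k\<le>n. C * r ^ n)" unfolding S by (intro sum_mono) auto
    thus ?thesis by (simp add: algebra_simps)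
  qed
  have root: "(a * r ^ n) powr (1 / real n) = root n a * r" if "0 < a" "0 < n" for a n
    using that r by (simp flip: root_powr_inverse add: real_root_mult real_root_power_cancel)
  have "(\<lambda>n. S n powr (1 / real n)) \<longlonglongrightarrow> r"
  proof (rule real_tendsto_sandwich)
    show "(\<lambda>n. root n c * r) \<longlonglongrightarrow> r"
      using tendsto_mult[OF LIMSEQ_root_const[OF cC(1)] tendsto_const[of r]] by simp
    show "(\<lambda>n. root n (real n) * root n (2 * C) * r) \<longlonglongrightarrow> r"
      using tendsto_mult[OF tendsto_mult[OF LIMSEQ_root LIMSEQ_root_const[of "2 * C"]]
          tendsto_const[of r]] cC(2) by simp
    show "\<forall>\<^sub>F n in sequentially. root n c * r \<le> S n powr (1 / real n)"
      using eventually_gt_at_top[of 0]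
    proof eventually_elim
      case (elim n)
      have "(c * r ^ n) powr (1 / real n) \<le> S n powr (1 / real n)"
        using cC(1) r by (intro powr_mono2 lo) auto
      thus ?case using root[OF cC(1) elim] by simp
    qed
    show "\<forall>\<^sub>F n in sequentially. S n powr (1 / real n) \<le> root n (real n) * root n (2 * C) * r"
      using eventually_gt_at_top[of 0]
    proof eventually_elim
      case (elim n)
      have "(real n + 1) * C * r ^ n \<le> (2 * real n) * C * r ^ n"
        using cC(2) r elim by (intro mult_right_mono) auto
      hence "S n powr (1 / real n) \<le> (real n * (2 * C) * r ^ n) powr (1 / real n)"
        using up[of n] by (intro powr_mono2) (auto simp: S s0 sum_nonneg mult_ac)
      thus ?case using root[of "real n * (2 * C)" n] cC(2) elim by (simp add: real_root_mult)
    qed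
  qed
  thus ?thesis unfolding S_def .
qed

text \<open>The infimum is a minimum, attained at the two letters.\<close>

lemma omega_eq_root: "omega [] U_bar U_N (wdim \<delta>) = r"
proof -
  let ?X = "{[True], [False]}"
  have "omega_X [] U_N (wdim \<delta>) ?X = r"
    using LIMSEQ_unique[OF omega_X_limit[OF gen_set_letters delta_ge_2]] words_size_root_limit
    by (simp add: ball_X_letters)
  moreover have "r \<le> omega_X [] U_N (wdim \<delta>) X" if X: "gen_set U_bar U_N X" for X
  proof (rule LIMSEQ_le[OF words_size_root_limit omega_X_limit[OF X delta_ge_2]])
    show "\<exists>N. \<forall>n\<ge>N. set_size (wdim \<delta>) {w. length w \<le> n} powr (1 / real n)
        \<le> set_size (wdim \<delta>) (ball_X [] U_N X n) powr (1 / real n)"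
      using set_size_words_le_set_size_ball[OF delta_ge_2 X]
      by (intro exI allI impI powr_mono2) (auto simp: set_size_def sum_nonneg)
  qed
  ultimately show ?thesis
    unfolding omega_def using gen_set_letters by (intro cInf_eq_minimum) (auto simp: image_iff)
qed

end

section \<open>Locating the largest root of \<open>P_q\<close>\<close>

lemma P_q_eq:
  assumes "q \<noteq> 0"
  shows "P_q q z = z ^ 3 - (2 * (q + 1 / q)\<^sup>2 - 1) * z\<^sup>2 + (2 * (q + 1 / q)\<^sup>2 - 2) * z - 2"
  using assms by (simp add: P_q_def power2_sum power_divide algebra_simps)

text \<open>\<open>Max\<close> needs a finite nonempty set of roots. With A =
  \<open>2 * \<delta>\<^sup>2 - 2\<close> the polynomial is z^2 (z - A - 1) + A z - 2, which is -2
  at A and nonnegative at A + 1, so a root lies between.\<close>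

lemma r_q_root:
  assumes "0 < q"
  shows "P_q q (r_q q) = 0" "2 * (q + 1 / q)\<^sup>2 - 2 < r_q q"
proof -
  define \<delta> where "\<delta> = q + 1 / q"
  have P: "P_q q z = z ^ 3 - (2 * \<delta>\<^sup>2 - 1) * z\<^sup>2 + (2 * \<delta>\<^sup>2 - 2) * z - 2" for z
    unfolding \<delta>_def using assms by (intro P_q_eq) auto
  have d2: "4 \<le> \<delta>\<^sup>2"
  proof -
    have "\<delta>\<^sup>2 = 4 + (q - 1 / q)\<^sup>2"
      using assms by (simp add: \<delta>_def power2_sum power2_diff)
    thus ?thesis by simp
  qed
  let ?p = "[:- 2, 2 * \<delta>\<^sup>2 - 2, - (2 * \<delta>\<^sup>2 - 1), 1:]"
  have "{z. P_q q z = 0} = {z. poly ?p z = 0}"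
    by (auto simp: P power2_eq_square power3_eq_cube algebra_simps)
  moreover have "finite {z. poly ?p z = 0}" by (rule poly_roots_finite) simp
  ultimately have fin: "finite {z. P_q q z = 0}" by simp
  have lo: "P_q q (2 * \<delta>\<^sup>2 - 2) = - 2"
    unfolding P by algebra
  have "P_q q (2 * \<delta>\<^sup>2 - 1) = (2 * \<delta>\<^sup>2 - 2) * (2 * \<delta>\<^sup>2 - 1) - 2"
    unfolding P by algebra
  also have "1 * 2 \<le> (2 * \<delta>\<^sup>2 - 2) * (2 * \<delta>\<^sup>2 - 1)"
    using d2 by (intro mult_mono) auto
  ultimately have hi: "0 \<le> P_q q (2 * \<delta>\<^sup>2 - 1)" by linarith
  have "\<exists>z\<ge>2 * \<delta>\<^sup>2 - 2. z \<le> 2 * \<delta>\<^sup>2 - 1 \<and> P_q q z = 0"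
    using lo hi by (intro IVT') (auto simp: P intro!: continuous_intros)
  then obtain z where z: "2 * \<delta>\<^sup>2 - 2 \<le> z" "P_q q z = 0" by blast
  have "z \<noteq> 2 * \<delta>\<^sup>2 - 2" using z(2) lo by auto
  thus "2 * (q + 1 / q)\<^sup>2 - 2 < r_q q"
    using z Max_ge[OF fin, of z] unfolding r_q_def \<delta>_def by simp
  show "P_q q (r_q q) = 0"
    using Max_in[OF fin] z(2) unfolding r_q_def by blast
qed

theorem theorem7p7:
  fixes F :: "complex^'n^'n" and q :: real
  assumes "CARD('n) \<ge> 2"
    and "invertible F"
    and "trace (adjoint_mat F ** F) = trace (matrix_inv (adjoint_mat F ** F))"
    and "0 < q" and "q \<le> 1"
    and "complex_of_real (q + 1 / q) = trace (adjoint_mat F ** F)"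
  shows "omega U_e U_bar U_N (qdim q) = r_q q \<and> r_q q > 1"
proof -
  have q: "0 < q" "q \<le> 1" by fact+
  define \<delta> where "\<delta> = q + 1 / q"
  have "0 \<le> (1 - q)\<^sup>2 / q" using q by simp
  also have "\<dots> = \<delta> - 2" using q by (simp add: \<delta>_def power2_eq_square field_simps)
  finally have d: "2 \<le> \<delta>" by simp
  have root: "r_q q ^ 3 - (2 * \<delta>\<^sup>2 - 1) * (r_q q)\<^sup>2 + (2 * \<delta>\<^sup>2 - 2) * r_q q - 2 = 0"
    using r_q_root(1)[OF q(1)] P_q_eq[of q "r_q q"] q by (simp add: \<delta>_def)
  have gt: "2 * \<delta>\<^sup>2 - 2 < r_q q" using r_q_root(2)[OF q(1)] by (simp add: \<delta>_def)
  have "qdim q = wdim \<delta>" using qdim_eq_wdim[OF q] by (auto simp: \<delta>_def)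
  hence "omega U_e U_bar U_N (qdim q) = r_q q"
    using omega_eq_root[OF d root gt] by (simp add: U_e_def)
  thus ?thesis using r_gt_2_delta[OF d root gt] d by simp
qed

end
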